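(* Let $\mathcal{H}$ be a complex Hilbert space, let $A\in\mathcal{B}(\mathcal{H})$ be a positive operator, let $B=\begin{pmatrix} A & O \\ O & A \end{pmatrix}$ on $\mathcal{H}\oplus\mathcal{H}$, and let $X,Y,Z,W\in\mathcal{B}_A(\mathcal{H})$. Then $$\begin{aligned} w_B^2\begin{pmatrix} X & Y \\ Z & W \end{pmatrix}\le{}&\max\{w_A^2(X),w_A^2(W)\}+\frac12\max\{w_A(YZ),w_A(ZY)\}+w_B\begin{pmatrix} O & YW \\ ZX & O \end{pmatrix} \\ &+\frac14\max\left\{\|YY^{\sharp_A}+Z^{\sharp_A}Z\|_A,\ \|Y^{\sharp_A}Y+ZZ^{\sharp_A}\|_A\right\} \\ &+\frac12\max\left\{\|X^{\sharp_A}X+YY^{\sharp_A}\|_A,\ \|W^{\sharp_A}W+ZZ^{\sharp_A}\|_A\right\}.\end{aligned}$$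
   Context: $\mathcal{H}$ is a complex Hilbert space with inner product $\langle\cdot,\cdot\rangle$ (linear in the first variable), $\mathcal{B}(\mathcal{H})$ is the algebra of bounded linear operators on $\mathcal{H}$, $O$ is the zero operator, and $A\in\mathcal{B}(\mathcal{H})$ is a positive operator (i.e. $\langle Ax,x\rangle\ge 0$ for all $x$; not necessarily injective or with closed range). Put $\langle x,y\rangle_A=\langle Ax,y\rangle$ and $\|x\|_A=\sqrt{\langle x,x\rangle_A}$. An operator $R\in\mathcal{B}(\mathcal{H})$ is an $A$-adjoint of $T\in\mathcal{B}(\mathcal{H})$ if $\langle Tx,y\rangle_A=\langle x,Ry\rangle_A$ for all $x,y\in\mathcal{H}$. $\mathcal{B}_A(\mathcal{H})$ is the set of all $T\in\mathcal{B}(\mathcal{H})$ admitting an $A$-adjoint; equivalently, $R(T^*A)\subseteq R(A)$, where $R(\cdot)$ denotes range. For $T\in\mathcal{B}_A(\mathcal{H})$, $T^{\sharp_A}$ denotes the unique $A$-adjoint with range contained in $\overline{R(A)}$, i.e. the unique solution $S$ of $AS=T^*A$ with $R(S)\subseteq\overline{R(A)}$. For $T\in\mathcal{B}_A(\mathcal{H})$, the $A$-operator seminorm is $\|T\|_A=\sup\{\|Tx\|_A: x\in\mathcal{H},\ \|x\|_A=1\}$ and the $A$-numerical radius is $w_A(T)=\sup\{|\langle Tx,x\rangle_A|: x\in\mathcal{H},\ \|x\|_A=1\}$. The operator $B$ is positive on the Hilbert space $\mathcal{H}\oplus\mathcal{H}$, and $\langle\cdot,\cdot\rangle_B$, $\|\cdot\|_B$,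 $w_B(\cdot)$ are defined by the same formulas with $(\mathcal{H},A)$ replaced by $(\mathcal{H}\oplus\mathcal{H},B)$; $2\times2$ operator matrices with entries in $\mathcal{B}_A(\mathcal{H})$ act on $\mathcal{H}\oplus\mathcal{H}$ in the usual way (and belong to $\mathcal{B}_B(\mathcal{H}\oplus\mathcal{H})$). Write $w_A^2(T)=(w_A(T))^2$ and similarly $w_B^2$. *)

theory Defs
  imports "HOL-Analysis.Analysis"
begin

text \<open>
  The inner product is linear in its first argument.  The underlying real inner product of
  \<^class>\<open>real_inner\<close> is required to be its real part; together with conjugate symmetry this
  makes \<open>cinner x x\<close> the nonnegative real \<open>(norm x)\<^sup>2\<close>, so definiteness is inherited
  from \<^class>\<open>real_inner\<close>.
\<close>

class complex_inner = real_inner +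
  fixes scaleC :: "complex \<Rightarrow> 'a \<Rightarrow> 'a"  (infixr \<open>*\<^sub>C\<close> 75)
    and cinner :: "'a \<Rightarrow> 'a \<Rightarrow> complex"
  assumes scaleC_of_real: "complex_of_real r *\<^sub>C x = r *\<^sub>R x"
    and scaleC_add_right: "c *\<^sub>C (x + y) = c *\<^sub>C x + c *\<^sub>C y"
    and scaleC_add_left: "(c + d) *\<^sub>C x = c *\<^sub>C x + d *\<^sub>C x"
    and scaleC_scaleC: "c *\<^sub>C d *\<^sub>C x = (c * d) *\<^sub>C x"
    and cinner_add_left: "cinner (x + y) z = cinner x z + cinner y z"
    and cinner_scaleC_left: "cinner (c *\<^sub>C x) y = c * cinner x y"
    and cinner_commute: "cinner x y = cnj (cinner y x)"
    and Re_cinner: "Re (cinner x y) = inner x y"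

class complex_hilbert = complex_inner + complete_space

instantiation prod :: (complex_inner, complex_inner) complex_inner
begin

definition scaleC_prod_def: "c *\<^sub>C p = (c *\<^sub>C fst p, c *\<^sub>C snd p)"

definition cinner_prod_def: "cinner p q = cinner (fst p) (fst q) + cinner (snd p) (snd q)"

instance
proof
  fix r :: real and c d :: complex and x y z :: "'a \<times> 'b"
  show "complex_of_real r *\<^sub>C x = r *\<^sub>R x"
    by (simp add: scaleC_prod_def scaleC_of_real scaleR_prod_def)
  show "c *\<^sub>C (x + y) = c *\<^sub>C x + c *\<^sub>C y"
    by (simp add: scaleC_prod_def scaleC_add_right)
  show "(c + d) *\<^sub>C x = c *\<^sub>C x + d *\<^sub>C x"
    by (simp add: scaleC_prod_def scaleC_add_left)
  show "c *\<^sub>C d *\<^sub>C x = (c * d) *\<^sub>C x"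
    by (simp add: scaleC_prod_def scaleC_scaleC)
  show "cinner (x + y) z = cinner x z + cinner y z"
    by (simp add: cinner_prod_def cinner_add_left)
  show "cinner (c *\<^sub>C x) y = c * cinner x y"
    by (simp add: cinner_prod_def scaleC_prod_def cinner_scaleC_left algebra_simps)
  show "cinner x y = cnj (cinner y x)"
    by (simp add: cinner_prod_def cinner_commute[of "fst x"] cinner_commute[of "snd x"])
  show "Re (cinner x y) = inner x y"
    by (simp add: cinner_prod_def Re_cinner inner_prod_def)
qed

end

instance prod :: (complex_hilbert, complex_hilbert) complex_hilbert ..

definition bounded_clinear :: "('a::complex_inner \<Rightarrow> 'b::complex_inner) \<Rightarrow> bool" where
  "bounded_clinear T \<longleftrightarrow> bounded_linear T \<and> (\<forall>c x. T (c *\<^sub>C x) = c *\<^sub>C T x)"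

definition positive_op :: "('a::complex_inner \<Rightarrow> 'a) \<Rightarrow> bool" where
  "positive_op A \<longleftrightarrow> bounded_clinear A \<and> (\<forall>x. cinner (A x) x \<in> \<real>\<^sub>\<ge>\<^sub>0)"

definition op_matrix ::
  "('a::complex_inner \<Rightarrow> 'a) \<Rightarrow> ('a \<Rightarrow> 'a) \<Rightarrow> ('a \<Rightarrow> 'a) \<Rightarrow> ('a \<Rightarrow> 'a) \<Rightarrow> 'a \<times> 'a \<Rightarrow> 'a \<times> 'a" where
  "op_matrix X Y Z W = (\<lambda>(x, y). (X x + Y y, Z x + W y))"

definition A_inner :: "('a::complex_inner \<Rightarrow> 'a) \<Rightarrow> 'a \<Rightarrow> 'a \<Rightarrow> complex" where
  "A_inner A x y = cinner (A x) y"

definition A_norm :: "('a::complex_inner \<Rightarrow> 'a) \<Rightarrow> 'a \<Rightarrow> real" where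
  "A_norm A x = sqrt (Re (A_inner A x x))"

definition is_A_adjoint ::
  "('a::complex_inner \<Rightarrow> 'a) \<Rightarrow> ('a \<Rightarrow> 'a) \<Rightarrow> ('a \<Rightarrow> 'a) \<Rightarrow> bool" where
  "is_A_adjoint A T R \<longleftrightarrow>
     bounded_clinear R \<and> (\<forall>x y. A_inner A (T x) y = A_inner A x (R y))"

definition A_adjointable :: "('a::complex_inner \<Rightarrow> 'a) \<Rightarrow> ('a \<Rightarrow> 'a) set" where
  "A_adjointable A = {T. bounded_clinear T \<and> (\<exists>R. is_A_adjoint A T R)}"

text \<open>The distinguished adjoint is meaningful only for \<open>T\<close> in \<open>A_adjointable A\<close>.\<close>

definition A_sharp :: "('a::complex_inner \<Rightarrow> 'a) \<Rightarrow> ('a \<Rightarrow> 'a) \<Rightarrow> ('a \<Rightarrow> 'a)" where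
  "A_sharp A T = (THE S. is_A_adjoint A T S \<and> range S \<subseteq> closure (range A))"

text \<open>
  The suprema below are over sets of nonnegative reals.  Inserting \<open>0\<close> matters only when no
  vector has \<open>A\<close>-norm one, that is \<open>A = 0\<close>, where the empty supremum is read as \<open>0\<close>.
\<close>

definition A_opnorm :: "('a::complex_inner \<Rightarrow> 'a) \<Rightarrow> ('a \<Rightarrow> 'a) \<Rightarrow> real" where
  "A_opnorm A T = Sup (insert 0 {A_norm A (T x) |x. A_norm A x = 1})"

definition A_numrad :: "('a::complex_inner \<Rightarrow> 'a) \<Rightarrow> ('a \<Rightarrow> 'a) \<Rightarrow> real" where
  "A_numrad A T = Sup (insert 0 {cmod (A_inner A (T x) x) |x. A_norm A x = 1})"

end

theory Submission
  imports Defs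
begin

text \<open>
  Split the operator matrix as \<open>D + S\<close> with \<open>D = diag(X, W)\<close> and \<open>S\<close> off-diagonal.  For a
  \<open>B\<close>-unit vector \<open>u\<close>, expand \<open>(|\<langle>Du,u\<rangle>| + |\<langle>Su,u\<rangle>|)\<^sup>2\<close>.  Both
  \<open>|\<langle>Su,u\<rangle>|\<^sup>2\<close> and \<open>|\<langle>Du,u\<rangle>| |\<langle>Su,u\<rangle>|\<close> have the shape
  \<open>|\<langle>a,u\<rangle>\<langle>u,S\<^sup>\<sharp>u\<rangle>|\<close>, so Buzano's inequality and the arithmetic-geometric mean
  inequality bound them through \<open>S\<^sup>2\<close>, \<open>S D\<close>, \<open>S\<^sup>\<sharp>S + S S\<^sup>\<sharp>\<close> and
  \<open>D\<^sup>\<sharp>D + S S\<^sup>\<sharp>\<close>.  Operators having an \<open>A\<close>-adjoint are \<open>A\<close>-bounded, so all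
  suprema are finite, and the distinguished adjoint is obtained from any \<open>A\<close>-adjoint by
  projecting onto the closure of the range of \<open>A\<close>.
\<close>

section \<open>Complex inner products\<close>

lemma cinner_add_right: "cinner x (y + z) = cinner x y + cinner x z"
  by (metis cinner_add_left cinner_commute complex_cnj_add)

lemma cinner_scaleC_right: "cinner x (c *\<^sub>C y) = cnj c * cinner x y"
  by (metis cinner_scaleC_left cinner_commute complex_cnj_mult)

lemma cinner_zero_left [simp]: "cinner 0 x = 0"
  using cinner_add_left[of 0 0 x] by simp

lemma cinner_zero_right [simp]: "cinner x 0 = 0"
  using cinner_add_right[of x 0 0] by simp

lemma cinner_minus_left: "cinner (- x) y = - cinner x y"
  using cinner_add_left[of x "- x" y] by (simp add: eq_neg_iff_add_eq_0 add.commute)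

lemma cinner_minus_right: "cinner x (- y) = - cinner x y"
  using cinner_add_right[of x y "- y"] by (simp add: eq_neg_iff_add_eq_0 add.commute)

lemma cinner_diff_left: "cinner (x - y) z = cinner x z - cinner y z"
  using cinner_add_left[of x "- y" z] by (simp add: cinner_minus_left)

lemma cinner_diff_right: "cinner x (y - z) = cinner x y - cinner x z"
  using cinner_add_right[of x y "- z"] by (simp add: cinner_minus_right)

text \<open>The norm is inherited from the real inner product, so complex homogeneity has to be
  recovered from \<open>Re_cinner\<close>.\<close>

lemma norm_scaleC: "norm (c *\<^sub>C x) = cmod c * norm x"
proof -
  have "inner (c *\<^sub>C x) (c *\<^sub>C x) = Re (c * cnj c * cinner x x)"
    by (simp add: Re_cinner[symmetric] cinner_scaleC_left cinner_scaleC_right mult_ac)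
  also have "c * cnj c = complex_of_real ((cmod c)\<^sup>2)"
    by (simp add: complex_norm_square[symmetric])
  finally have "(norm (c *\<^sub>C x))\<^sup>2 = (cmod c * norm x)\<^sup>2"
    by (simp add: power2_norm_eq_inner power_mult_distrib Re_cinner)
  then show ?thesis by simp
qed

lemma bounded_linear_scaleC: "bounded_linear ((*\<^sub>C) c)"
proof (rule bounded_linear_intro[where K = "cmod c"])
  fix r and x y :: 'a
  show "c *\<^sub>C (x + y) = c *\<^sub>C x + c *\<^sub>C y" by (rule scaleC_add_right)
  show "c *\<^sub>C r *\<^sub>R x = r *\<^sub>R c *\<^sub>C x"
    by (simp add: scaleC_of_real[symmetric] scaleC_scaleC mult.commute)
  show "norm (c *\<^sub>C x) \<le> norm x * cmod c" by (simp add: norm_scaleC)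
qed

lemma scaleC_zero_right [simp]: "c *\<^sub>C 0 = 0"
  using scaleC_add_right[of c 0 0] by simp

section \<open>Bounded complex-linear maps\<close>

lemma bounded_clinear_zero: "bounded_clinear (\<lambda>_. 0)"
  by (simp add: bounded_clinear_def)

lemma bounded_clinear_add:
  "bounded_clinear S \<Longrightarrow> bounded_clinear T \<Longrightarrow> bounded_clinear (\<lambda>x. S x + T x)"
  by (simp add: bounded_clinear_def bounded_linear_add scaleC_add_right)

lemma bounded_clinear_compose:
  "bounded_clinear S \<Longrightarrow> bounded_clinear T \<Longrightarrow> bounded_clinear (\<lambda>x. S (T x))"
  by (simp add: bounded_clinear_def bounded_linear_compose)

lemma bounded_clinear_op_matrix:
  assumes "bounded_clinear X" "bounded_clinear Y" "bounded_clinear Z" "bounded_clinear W"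
  shows "bounded_clinear (op_matrix X Y Z W)"
proof -
  have "bounded_linear (\<lambda>p. (X (fst p) + Y (snd p), Z (fst p) + W (snd p)))"
    using assms[unfolded bounded_clinear_def, THEN conjunct1]
    by (intro bounded_linear_Pair bounded_linear_add)
      (auto intro: bounded_linear_compose[OF _ bounded_linear_fst]
        bounded_linear_compose[OF _ bounded_linear_snd])
  then show ?thesis
    using assms
    by (simp add: bounded_clinear_def op_matrix_def case_prod_unfold scaleC_prod_def scaleC_add_right)
qed

lemma bounded_clinear_addD: "bounded_clinear T \<Longrightarrow> T (x + y) = T x + T y"
  by (simp add: bounded_clinear_def linear_simps)

lemma bounded_clinear_diffD: "bounded_clinear T \<Longrightarrow> T (x - y) = T x - T y"
  by (simp add: bounded_clinear_def linear_simps)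

lemma bounded_clinear_scaleCD: "bounded_clinear T \<Longrightarrow> T (c *\<^sub>C x) = c *\<^sub>C T x"
  by (simp add: bounded_clinear_def)

section \<open>The semi-inner product of a positive operator\<close>

lemma positive_op_bounded_clinear: "positive_op A \<Longrightarrow> bounded_clinear A"
  by (simp add: positive_op_def)

lemma A_inner_add_left: "positive_op A \<Longrightarrow> A_inner A (x + y) z = A_inner A x z + A_inner A y z"
  by (simp add: A_inner_def positive_op_bounded_clinear bounded_clinear_addD cinner_add_left)

lemma A_inner_diff_left: "positive_op A \<Longrightarrow> A_inner A (x - y) z = A_inner A x z - A_inner A y z"
  by (simp add: A_inner_def positive_op_bounded_clinear bounded_clinear_diffD cinner_diff_left)

lemma A_inner_scaleC_left: "positive_op A \<Longrightarrow> A_inner A (c *\<^sub>C x) y = c * A_inner A x y"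
  by (simp add: A_inner_def positive_op_bounded_clinear bounded_clinear_scaleCD cinner_scaleC_left)

lemma A_inner_add_right: "A_inner A x (y + z) = A_inner A x y + A_inner A x z"
  by (simp add: A_inner_def cinner_add_right)

lemma A_inner_diff_right: "A_inner A x (y - z) = A_inner A x y - A_inner A x z"
  by (simp add: A_inner_def cinner_diff_right)

lemma A_inner_scaleC_right: "A_inner A x (c *\<^sub>C y) = cnj c * A_inner A x y"
  by (simp add: A_inner_def cinner_scaleC_right)

lemmas A_inner_simps = A_inner_add_left A_inner_diff_left A_inner_scaleC_left
  A_inner_add_right A_inner_diff_right A_inner_scaleC_right

lemma A_inner_self:
  assumes "positive_op A"
  shows "Im (A_inner A x x) = 0" "0 \<le> Re (A_inner A x x)"
  using assms by (auto simp: positive_op_def A_inner_def complex_nonneg_Reals_iff)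

text \<open>Polarization: the form is real on the diagonal. Expanding it at \<open>x + y\<close>
  matches the imaginary parts, and at x + iy the real parts.\<close>

lemma A_inner_commute:
  assumes A: "positive_op A"
  shows "A_inner A x y = cnj (A_inner A y x)"
proof (rule complex_eqI)
  show "Im (A_inner A x y) = Im (cnj (A_inner A y x))"
    using A_inner_self(1)[OF A, of "x + y"] A_inner_self(1)[OF A]
    by (simp add: A_inner_simps A)
  show "Re (A_inner A x y) = Re (cnj (A_inner A y x))"
    using A_inner_self(1)[OF A, of "x + \<i> *\<^sub>C y"] A_inner_self(1)[OF A]
    by (simp add: A_inner_simps A)
qed

lemma positive_op_selfadjoint:
  assumes "positive_op A"
  shows "cinner (A x) y = cinner x (A y)"
  using A_inner_commute[OF assms, of x y] cinner_commute[of x "A y"] by (simp add: A_inner_def)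

lemma A_norm_nonneg: "positive_op A \<Longrightarrow> 0 \<le> A_norm A x"
  by (simp add: A_norm_def A_inner_self)

lemma A_norm_square: "positive_op A \<Longrightarrow> (A_norm A x)\<^sup>2 = Re (A_inner A x x)"
  by (simp add: A_norm_def A_inner_self)

lemma A_inner_self_eq: "positive_op A \<Longrightarrow> A_inner A x x = complex_of_real ((A_norm A x)\<^sup>2)"
  by (simp add: complex_eq_iff A_norm_square A_inner_self)

lemma A_norm_scaleC:
  assumes "positive_op A"
  shows "A_norm A (c *\<^sub>C x) = cmod c * A_norm A x"
proof -
  have "A_inner A (c *\<^sub>C x) (c *\<^sub>C x) = (c * cnj c) * A_inner A x x"
    using assms by (simp add: A_inner_simps mult_ac)
  also have "\<dots> = complex_of_real ((cmod c * A_norm A x)\<^sup>2)"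
    using assms by (simp add: A_inner_self_eq complex_norm_square[symmetric] power_mult_distrib)
  finally have "(A_norm A (c *\<^sub>C x))\<^sup>2 = (cmod c * A_norm A x)\<^sup>2"
    using assms by (simp add: A_norm_square)
  then show ?thesis using assms by (simp add: A_norm_nonneg)
qed

text \<open>Positivity at \<open>x - (t * f) *\<^sub>C y\<close>, for real \<open>t\<close>, gives a
  nonnegative quadratic in \<open>t\<close>. The form may be degenerate, so \<open>y\<close> of
  seminorm zero is a separate case.\<close>

lemma A_Cauchy_Schwarz:
  assumes A: "positive_op A"
  shows "cmod (A_inner A x y) \<le> A_norm A x * A_norm A y"
proof -
  define f where "f = A_inner A x y"
  have ineq: "0 \<le> (A_norm A x)\<^sup>2 - 2 * t * (cmod f)\<^sup>2 + t\<^sup>2 * (cmod f)\<^sup>2 * (A_norm A y)\<^sup>2" for t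
  proof -
    have yx: "A_inner A y x = cnj f" unfolding f_def by (rule A_inner_commute[OF A])
    let ?c = "complex_of_real t * f"
    have "A_inner A (x - ?c *\<^sub>C y) (x - ?c *\<^sub>C y)
        = A_inner A x x - 2 * of_real t * (f * cnj f) + (of_real t)\<^sup>2 * (f * cnj f) * A_inner A y y"
      using A yx by (simp add: A_inner_simps f_def[symmetric] algebra_simps power2_eq_square)
    also have "\<dots> = complex_of_real
        ((A_norm A x)\<^sup>2 - 2 * t * (cmod f)\<^sup>2 + t\<^sup>2 * (cmod f)\<^sup>2 * (A_norm A y)\<^sup>2)"
      using A by (simp add: A_inner_self_eq complex_norm_square[symmetric])
    finally show ?thesis using A_inner_self(2)[OF A, of "x - ?c *\<^sub>C y"] by simp
  qed
  have "(cmod f)\<^sup>2 \<le> (A_norm A x * A_norm A y)\<^sup>2"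
  proof (cases "A_norm A y = 0")
    case True
    have "f = 0"
    proof (rule ccontr)
      assume "f \<noteq> 0"
      then show False
        \<comment> \<open>The quadratic is now affine in \<open>t\<close>, and this \<open>t\<close>
          gives it the value -1.\<close>
        using ineq[of "((A_norm A x)\<^sup>2 + 1) / (2 * (cmod f)\<^sup>2)"] True by (simp add: field_simps)
    qed
    then show ?thesis by simp
  next
    case False
    then have pos: "0 < (A_norm A y)\<^sup>2" by simp
    then have "(1 / (A_norm A y)\<^sup>2)\<^sup>2 * (cmod f)\<^sup>2 * (A_norm A y)\<^sup>2 = (cmod f)\<^sup>2 / (A_norm A y)\<^sup>2"
      by (simp add: power2_eq_square)
    \<comment> \<open>This \<open>t\<close> minimizes the quadratic when \<open>f\<close> is
      nonzero.\<close>
    with ineq[of "1 / (A_norm A y)\<^sup>2"] have "(cmod f)\<^sup>2 / (A_norm A y)\<^sup>2 \<le> (A_norm A x)\<^sup>2"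
      by simp
    with pos show ?thesis by (simp add: pos_divide_le_eq power_mult_distrib)
  qed
  then show ?thesis
    using A by (simp add: f_def A_norm_nonneg power2_le_iff_abs_le)
qed

text \<open>Reflecting \<open>a\<close> in the line of the unit vector \<open>e\<close> preserves its seminorm; apply
  Cauchy-Schwarz to the reflection and \<open>b\<close>.\<close>

lemma A_Buzano:
  assumes A: "positive_op A" and e: "A_norm A e = 1"
  shows "2 * cmod (A_inner A a e * A_inner A e b)
    \<le> A_norm A a * A_norm A b + cmod (A_inner A a b)"
proof -
  define f where "f = A_inner A a e"
  define r where "r = (2 * f) *\<^sub>C e - a"
  have ea: "A_inner A e a = cnj f" and ee: "A_inner A e e = 1"
    using A_inner_commute[OF A, of e a] A_inner_self_eq[OF A, of e] e by (simp_all add: f_def)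
  have "A_inner A r r = A_inner A a a"
    using A ea ee by (simp add: r_def A_inner_simps f_def[symmetric] algebra_simps)
  then have "A_norm A r = A_norm A a" by (simp add: A_norm_def)
  moreover have "A_inner A r b = 2 * (f * A_inner A e b) - A_inner A a b"
    using A by (simp add: r_def A_inner_simps)
  ultimately have "cmod (2 * (f * A_inner A e b) - A_inner A a b) \<le> A_norm A a * A_norm A b"
    using A_Cauchy_Schwarz[OF A, of r b] by simp
  moreover have "cmod (2 * (f * A_inner A e b))
      \<le> cmod (2 * (f * A_inner A e b) - A_inner A a b) + cmod (A_inner A a b)"
    by (metis diff_add_cancel norm_triangle_ineq)
  ultimately show ?thesis by (simp add: f_def norm_mult)
qed

section \<open>Adjoints\<close>

lemma is_A_adjoint_sym:
  assumes "positive_op A" "bounded_clinear T" "is_A_adjoint A T R"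
  shows "is_A_adjoint A R T"
  using assms unfolding is_A_adjoint_def by (metis A_inner_commute)

lemma A_adjointable_bounded_clinear: "T \<in> A_adjointable A \<Longrightarrow> bounded_clinear T"
  by (simp add: A_adjointable_def)

lemma A_adjointableI: "bounded_clinear T \<Longrightarrow> is_A_adjoint A T R \<Longrightarrow> T \<in> A_adjointable A"
  by (auto simp: A_adjointable_def)

lemma A_adjointable_add:
  assumes A: "positive_op A" and "S \<in> A_adjointable A" "T \<in> A_adjointable A"
  shows "(\<lambda>x. S x + T x) \<in> A_adjointable A"
proof -
  from assms obtain S' T' where "is_A_adjoint A S S'" "is_A_adjoint A T T'"
    by (auto simp: A_adjointable_def)
  then have "is_A_adjoint A (\<lambda>x. S x + T x) (\<lambda>x. S' x + T' x)"
    using A by (simp add: is_A_adjoint_def A_inner_simps bounded_clinear_add)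
  then show ?thesis
    using assms by (auto intro: A_adjointableI bounded_clinear_add A_adjointable_bounded_clinear)
qed

lemma A_adjointable_compose:
  assumes "S \<in> A_adjointable A" "T \<in> A_adjointable A"
  shows "(\<lambda>x. S (T x)) \<in> A_adjointable A"
proof -
  from assms obtain S' T' where "is_A_adjoint A S S'" "is_A_adjoint A T T'"
    by (auto simp: A_adjointable_def)
  then have "is_A_adjoint A (\<lambda>x. S (T x)) (\<lambda>x. T' (S' x))"
    by (simp add: is_A_adjoint_def bounded_clinear_compose)
  then show ?thesis
    using assms by (auto intro: A_adjointableI bounded_clinear_compose A_adjointable_bounded_clinear)
qed

lemma is_A_adjoint_zero: "positive_op A \<Longrightarrow> is_A_adjoint A (\<lambda>_. 0) (\<lambda>_. 0)"
  by (auto simp: is_A_adjoint_def A_inner_def positive_op_def bounded_clinear_def linear_simps)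

lemma A_adjointable_zero: "positive_op A \<Longrightarrow> (\<lambda>_. 0) \<in> A_adjointable A"
  by (rule A_adjointableI[OF bounded_clinear_zero is_A_adjoint_zero])

text \<open>For the \<open>A\<close>-selfadjoint operator \<open>M = R T\<close>, iterating
  \<open>\<parallel>N x\<parallel>\<^sub>A\<^sup>2 \<le> \<parallel>x\<parallel>\<^sub>A \<parallel>N\<^sup>2 x\<parallel>\<^sub>A\<close> along \<open>N = M^(2^n)\<close> compares
  \<open>\<parallel>M x\<parallel>\<^sub>A^(2^n)\<close> with the growth of \<open>\<parallel>M\<parallel>^(2^n)\<close>.\<close>

lemma A_adjointable_bounded:
  assumes A: "positive_op A" and T: "T \<in> A_adjointable A"
  obtains K where "0 \<le> K" "\<And>x. A_norm A x = 1 \<Longrightarrow> A_norm A (T x) \<le> K"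
proof -
  from T obtain R where R: "is_A_adjoint A T R" by (auto simp: A_adjointable_def)
  define M where "M = (\<lambda>x. R (T x))"
  have "bounded_clinear M"
    using R T by (auto simp: M_def is_A_adjoint_def A_adjointable_def intro: bounded_clinear_compose)
  then have "bounded_linear M" by (simp add: bounded_clinear_def)
  then obtain k where k: "\<And>x. norm (M x) \<le> norm x * k" by (auto dest: bounded_linear.bounded)
  \<comment> \<open>The maximum with 1 keeps \<open>K\<close> positive, so that it can be divided by
    below.\<close>
  define K where "K = max 1 k"
  have K: "norm (M x) \<le> K * norm x" for x
    using order_trans[OF k[of x] mult_left_mono[of k K "norm x"]]
    by (simp add: K_def mult.commute)
  have K1: "1 \<le> K" by (simp add: K_def)
  have pow_norm: "norm ((M ^^ m) x) \<le> K ^ m * norm x" for m x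
  proof (induction m)
    case (Suc m)
    have "norm ((M ^^ Suc m) x) \<le> K * norm ((M ^^ m) x)" using K by simp
    also have "\<dots> \<le> K * (K ^ m * norm x)" using Suc K1 by (intro mult_left_mono) auto
    finally show ?case by simp
  qed simp
  have self: "A_inner A (M x) y = A_inner A x (M y)" for x y
    using is_A_adjoint_sym[OF A _ R] R T by (simp add: M_def is_A_adjoint_def A_adjointable_def)
  have self_pow: "A_inner A ((M ^^ m) x) y = A_inner A x ((M ^^ m) y)" for m x y
    by (induction m arbitrary: x y) (simp_all add: self flip: funpow_swap1)
  have "bounded_linear A" using A by (simp add: positive_op_def bounded_clinear_def)
  then obtain a where a: "\<And>x. norm (A x) \<le> norm x * a" and a0: "0 \<le> a"
    using bounded_linear.nonneg_bounded by blast
  have A_norm_le: "A_norm A x \<le> sqrt a * norm x" for x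
  proof -
    have "Re (A_inner A x x) \<le> norm (A x) * norm x"
      by (simp add: A_inner_def Re_cinner norm_cauchy_schwarz)
    also have "\<dots> \<le> norm x * a * norm x" using a by (intro mult_right_mono) auto
    finally have "Re (A_inner A x x) \<le> a * (norm x)\<^sup>2" by (simp add: power2_eq_square mult_ac)
    then show ?thesis
      unfolding A_norm_def by (metis real_sqrt_le_mono real_sqrt_mult real_sqrt_abs abs_norm_cancel)
  qed
  have M_le: "A_norm A (M x) \<le> K" if x: "A_norm A x = 1" for x
  proof -
    have growth: "A_norm A (M x) ^ (2 ^ n) \<le> A_norm A ((M ^^ (2 ^ n)) x)" for n
    proof (induction n)
      case (Suc n)
      have "A_norm A (M x) ^ (2 ^ Suc n) = (A_norm A (M x) ^ (2 ^ n))\<^sup>2"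
        by (simp add: power_mult[symmetric] mult.commute)
      also have "\<dots> \<le> (A_norm A ((M ^^ (2 ^ n)) x))\<^sup>2"
        using Suc A by (intro power_mono) (auto simp: A_norm_nonneg)
      also have "\<dots> = Re (A_inner A x ((M ^^ (2 ^ Suc n)) x))"
        using A by (simp add: A_norm_square self_pow funpow_add mult_2)
      also have "\<dots> \<le> A_norm A ((M ^^ (2 ^ Suc n)) x)"
        using A_Cauchy_Schwarz[OF A, of x "(M ^^ (2 ^ Suc n)) x"] complex_Re_le_cmod x
        by (metis mult_1 order_trans)
      finally show ?case .
    qed simp
    show ?thesis
    \<comment> \<open>A ratio above 1 would have unbounded powers, whereas \<open>growth\<close>,
      \<open>A_norm_le\<close> and \<open>pow_norm\<close> bound its powers with exponent 2^n by
      \<open>sqrt a * norm x\<close>.\<close>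
    proof (rule ccontr)
      assume "\<not> A_norm A (M x) \<le> K"
      then have q: "1 < A_norm A (M x) / K" using K1 by simp
      then obtain n where n: "sqrt a * norm x < (A_norm A (M x) / K) ^ n"
        using real_arch_pow by blast
      \<comment> \<open>The Archimedean exponent \<open>n\<close> is raised to 2^n, the only
        exponents that \<open>growth\<close> covers.\<close>
      also have "\<dots> \<le> (A_norm A (M x) / K) ^ (2 ^ n)"
        using q by (intro power_increasing) (auto simp: less_imp_le)
      finally have "sqrt a * norm x * K ^ (2 ^ n) < A_norm A (M x) ^ (2 ^ n)"
        using K1 by (simp add: power_divide field_simps)
      also have "\<dots> \<le> sqrt a * norm ((M ^^ (2 ^ n)) x)"
        using growth A_norm_le order_trans by blast
      also have "\<dots> \<le> sqrt a * (K ^ (2 ^ n) * norm x)"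
        using a0 pow_norm by (intro mult_left_mono) auto
      finally show False by (simp add: mult_ac)
    qed
  qed
  show thesis
  proof
    show "0 \<le> sqrt K" using K1 by simp
    fix x assume x: "A_norm A x = 1"
    \<comment> \<open>The bound on \<open>M = R T\<close> controls the square of the seminorm of
      \<open>T x\<close>, hence the square root of \<open>K\<close>.\<close>
    have "Re (A_inner A (T x) (T x)) = Re (A_inner A x (M x))"
      using R by (simp add: is_A_adjoint_def M_def)
    also have "\<dots> \<le> A_norm A (M x)"
      using A_Cauchy_Schwarz[OF A, of x "M x"] complex_Re_le_cmod x by (metis mult_1 order_trans)
    also have "\<dots> \<le> K" using M_le x by simp
    finally show "A_norm A (T x) \<le> sqrt K" by (simp add: A_norm_def)
  qed
qed

text \<open>Both sides scale quadratically, so a vector of nonzero seminorm can be normalized. At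
  seminorm zero, Cauchy-Schwarz makes the left side vanish.\<close>

lemma cmod_A_inner_le_scaled:
  assumes A: "positive_op A" and T: "bounded_clinear T"
    and unit: "\<And>x. A_norm A x = 1 \<Longrightarrow> cmod (A_inner A (T x) x) \<le> k"
  shows "cmod (A_inner A (T x) x) \<le> k * (A_norm A x)\<^sup>2"
proof (cases "A_norm A x = 0")
  case True
  then show ?thesis using A_Cauchy_Schwarz[OF A, of "T x" x] by simp
next
  case False
  define c where "c = complex_of_real (A_norm A x)"
  define y where "y = inverse c *\<^sub>C x"
  have c: "c \<noteq> 0" "cmod c = A_norm A x" using False A by (simp_all add: c_def A_norm_nonneg)
  have "A_norm A y = 1" using False A c by (simp add: y_def A_norm_scaleC norm_inverse)
  then have "cmod (A_inner A (T y) y) \<le> k" by (rule unit)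
  moreover have "A_inner A (T y) y = inverse c * (cnj (inverse c) * A_inner A (T x) x)"
    using A T by (simp add: y_def bounded_clinear_scaleCD A_inner_simps mult_ac)
  then have "cmod (A_inner A (T y) y) = cmod (A_inner A (T x) x) / (A_norm A x)\<^sup>2"
    by (simp only: norm_mult norm_inverse complex_cnj_inverse complex_mod_cnj c(2))
      (simp add: field_simps power2_eq_square)
  ultimately show ?thesis
    using False by (simp add: field_simps)
qed

text \<open>\<open>Sup\<close> dominates its set only once the set is known to be bounded;
  \<open>A_adjointable_bounded\<close> and Cauchy-Schwarz supply the bound. The inserted 0 yields
  nonnegativity.\<close>

lemma A_numrad_bound:
  assumes A: "positive_op A" and T: "T \<in> A_adjointable A"
  shows "0 \<le> A_numrad A T"
    and "cmod (A_inner A (T x) x) \<le> A_numrad A T * (A_norm A x)\<^sup>2"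
proof -
  obtain K where K: "0 \<le> K" "\<And>x. A_norm A x = 1 \<Longrightarrow> A_norm A (T x) \<le> K"
    using A_adjointable_bounded[OF A T] by blast
  let ?S = "insert 0 {cmod (A_inner A (T x) x) |x. A_norm A x = 1}"
  have "bdd_above ?S"
  proof (rule bdd_aboveI[of _ K])
    fix r assume "r \<in> ?S"
    then show "r \<le> K"
    proof safe
      fix x assume "A_norm A x = 1"
      then show "cmod (A_inner A (T x) x) \<le> K"
        using K(2)[of x] A_Cauchy_Schwarz[OF A, of "T x" x] by simp
    qed (rule K(1))
  qed
  then have upper: "r \<le> A_numrad A T" if "r \<in> ?S" for r
    unfolding A_numrad_def using that by (intro cSup_upper)
  then show "0 \<le> A_numrad A T" by simp
  show "cmod (A_inner A (T x) x) \<le> A_numrad A T * (A_norm A x)\<^sup>2"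
    using upper by (intro cmod_A_inner_le_scaled A A_adjointable_bounded_clinear[OF T]) auto
qed

lemma A_opnorm_bound:
  assumes A: "positive_op A" and T: "T \<in> A_adjointable A"
  shows "0 \<le> A_opnorm A T"
    and "cmod (A_inner A (T x) x) \<le> A_opnorm A T * (A_norm A x)\<^sup>2"
proof -
  obtain K where K: "0 \<le> K" "\<And>x. A_norm A x = 1 \<Longrightarrow> A_norm A (T x) \<le> K"
    using A_adjointable_bounded[OF A T] by blast
  let ?S = "insert 0 {A_norm A (T x) |x. A_norm A x = 1}"
  have "bdd_above ?S" using K by (auto intro!: bdd_aboveI[of _ K])
  then have upper: "r \<le> A_opnorm A T" if "r \<in> ?S" for r
    unfolding A_opnorm_def using that by (intro cSup_upper)
  then show "0 \<le> A_opnorm A T" by simp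
  show "cmod (A_inner A (T x) x) \<le> A_opnorm A T * (A_norm A x)\<^sup>2"
  proof (intro cmod_A_inner_le_scaled A A_adjointable_bounded_clinear[OF T])
    fix x assume x: "A_norm A x = 1"
    then have "A_norm A (T x) \<le> A_opnorm A T" by (intro upper) auto
    then show "cmod (A_inner A (T x) x) \<le> A_opnorm A T"
      using A_Cauchy_Schwarz[OF A, of "T x" x] x by simp
  qed
qed

section \<open>Orthogonal projection and the distinguished adjoint\<close>

text \<open>Near-minimizers of the squared distance to \<open>M\<close> form nested closed sets
  whose diameters shrink by the parallelogram law. Completeness gives a nearest point, and
  minimality along lines through it gives orthogonality.\<close>

lemma orthogonal_projection_exists:
  fixes M :: "'a::{real_inner, complete_space} set"
  assumes M: "subspace M" "closed M"
  obtains p where "p \<in> M" "\<And>m. m \<in> M \<Longrightarrow> inner (x - p) m = 0"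
proof -
  define d where "d = (INF m\<in>M. (norm (x - m))\<^sup>2)"
  have ne: "M \<noteq> {}" using M(1) subspace_0 by blast
  have d_le: "d \<le> (norm (x - m))\<^sup>2" if "m \<in> M" for m
    unfolding d_def using that by (intro cINF_lower) (auto intro!: bdd_belowI[of _ 0])
  \<comment> \<open>\<open>Suc n\<close> matters: with \<open>n\<close> in its place, the first set
    would read 1/0 as 0 and demand an exact minimizer.\<close>
  define S where "S n = {m \<in> M. (norm (x - m))\<^sup>2 \<le> d + 1 / real (Suc n)}" for n
  have "\<exists>p. \<forall>n. p \<in> S n"
  proof (rule decreasing_closed_nest)
    fix n
    have "closed {m. (norm (x - m))\<^sup>2 \<le> d + 1 / real (Suc n)}"
      by (intro closed_Collect_le continuous_intros)
    moreover have "S n = M \<inter> {m. (norm (x - m))\<^sup>2 \<le> d + 1 / real (Suc n)}"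
      by (auto simp: S_def)
    ultimately show "closed (S n)" using M(2) by (simp add: closed_Int)
    have "\<exists>m\<in>M. (norm (x - m))\<^sup>2 < d + 1 / real (Suc n)"
      using cInf_lessD[of "(\<lambda>m. (norm (x - m))\<^sup>2) ` M" "d + 1 / real (Suc n)"] ne
      by (simp add: d_def)
    then show "S n \<noteq> {}" by (fastforce simp: S_def)
  next
    fix m n :: nat assume "m \<le> n"
    then have "1 / real (Suc n) \<le> 1 / real (Suc m)" by (simp add: frac_le)
    then show "S n \<subseteq> S m" by (auto simp: S_def)
  next
    fix e :: real assume e: "0 < e"
    then obtain n where n: "inverse (real (Suc n)) < e\<^sup>2 / 4"
      using reals_Archimedean[of "e\<^sup>2 / 4"] by auto
    have "dist p q < e" if pq: "p \<in> S n" "q \<in> S n" for p q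
    proof -
      \<comment> \<open>The midpoint is at squared distance at least \<open>d\<close>, so the
        parallelogram law leaves only the two excesses, in total 4/(n+1).\<close>
      have "(1/2) *\<^sub>R (p + q) \<in> M"
        using pq M(1) by (simp add: S_def subspace_add subspace_scale)
      then have "d \<le> (norm (x - (1/2) *\<^sub>R (p + q)))\<^sup>2" by (rule d_le)
      moreover have "(norm (p - q))\<^sup>2 = 2 * (norm (x - p))\<^sup>2 + 2 * (norm (x - q))\<^sup>2
          - 4 * (norm (x - (1/2) *\<^sub>R (p + q)))\<^sup>2"
        unfolding power2_norm_eq_inner
        by (simp add: inner_simps inner_commute algebra_simps)
      ultimately have "(norm (p - q))\<^sup>2 \<le> 4 / real (Suc n)"
        using pq by (simp add: S_def)
      also have "\<dots> < e\<^sup>2" using n by (simp add: field_simps)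
      finally show ?thesis using e by (simp add: dist_norm power_less_imp_less_base)
    qed
    then show "\<exists>n. \<forall>x\<in>S n. \<forall>y\<in>S n. dist x y < e" by blast
  qed blast
  then obtain p where p: "\<And>n. p \<in> S n" by blast
  have pM: "p \<in> M" using p by (simp add: S_def)
  have p_min: "(norm (x - p))\<^sup>2 \<le> (norm (x - m))\<^sup>2" if "m \<in> M" for m
  proof -
    have "(norm (x - p))\<^sup>2 \<le> d"
    proof (rule field_le_epsilon)
      fix e :: real assume "0 < e"
      then obtain n where "inverse (real (Suc n)) < e" using reals_Archimedean by auto
      then show "(norm (x - p))\<^sup>2 \<le> d + e" using p[of n] by (simp add: S_def inverse_eq_divide)
    qed
    then show ?thesis using d_le[OF that] by (rule order_trans)
  qed
  have "inner (x - p) m = 0" if m: "m \<in> M" for m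
  proof (cases "m = 0")
    case False
    \<comment> \<open>This \<open>t\<close> makes \<open>p + t *\<^sub>R m\<close> the point closest
      to \<open>x\<close> on the line through \<open>p\<close> in direction
      \<open>m\<close>.\<close>
    define t where "t = inner (x - p) m / (norm m)\<^sup>2"
    have "p + t *\<^sub>R m \<in> M" using pM m M(1) by (simp add: subspace_add subspace_scale)
    from p_min[OF this]
    have "(norm (x - p))\<^sup>2 \<le> (norm (x - p))\<^sup>2 - 2 * t * inner (x - p) m + t\<^sup>2 * (norm m)\<^sup>2"
      unfolding power2_norm_eq_inner
      by (simp add: inner_simps inner_commute algebra_simps power2_eq_square)
    then have "(inner (x - p) m)\<^sup>2 \<le> 0"
      using False by (simp add: t_def field_simps power2_eq_square)
    then show ?thesis by simp
  qed simp
  with pM that show thesis by blast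
qed

lemma subspace_closure:
  fixes S :: "'a::real_normed_vector set"
  assumes "subspace S"
  shows "subspace (closure S)"
proof (rule subspaceI)
  show "0 \<in> closure S" using assms closure_subset subspace_0 by blast
next
  fix x y assume "x \<in> closure S" "y \<in> closure S"
  then obtain f g where "\<And>n. f n \<in> S" "f \<longlonglongrightarrow> x" "\<And>n. g n \<in> S" "g \<longlonglongrightarrow> y"
    by (auto simp: closure_sequential)
  then have "(\<forall>n. f n + g n \<in> S) \<and> (\<lambda>n. f n + g n) \<longlonglongrightarrow> x + y"
    using assms by (auto intro: subspace_add tendsto_add)
  then show "x + y \<in> closure S" unfolding closure_sequential by (intro exI)
next
  fix c x assume "x \<in> closure S"
  then have "c *\<^sub>R x \<in> closure ((*\<^sub>R) c ` S)" by (auto simp: closure_scaleR[symmetric])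
  also have "\<dots> \<subseteq> closure S"
    using assms by (intro closure_mono) (auto intro: subspace_scale)
  finally show "c *\<^sub>R x \<in> closure S" .
qed

lemma orthogonal_closure:
  fixes z :: "'a::real_inner"
  assumes "\<And>m. m \<in> M \<Longrightarrow> inner z m = 0" "m \<in> closure M"
  shows "inner z m = 0"
proof -
  have "closed {m. inner z m = 0}" by (intro closed_Collect_eq continuous_intros)
  then have "closure M \<subseteq> {m. inner z m = 0}"
    using assms(1) by (intro closure_minimal) auto
  with assms(2) show ?thesis by auto
qed

text \<open>The definite description needs existence and uniqueness. With \<open>P\<close> the
  projection onto the closure of the range of \<open>A\<close>, \<open>P R\<close> is a solution
  because A P = A. The difference of two solutions lies in that closure and is orthogonal to
  it.\<close>

lemma A_sharp_is_A_adjoint: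
  fixes A T :: "'a::complex_hilbert \<Rightarrow> 'a"
  assumes A: "positive_op A" and T: "T \<in> A_adjointable A"
  shows "is_A_adjoint A T (A_sharp A T)"
proof -
  from T obtain R where R: "is_A_adjoint A T R" by (auto simp: A_adjointable_def)
  define M where "M = closure (range A)"
  have lin_A: "bounded_linear A" "\<And>c x. A (c *\<^sub>C x) = c *\<^sub>C A x"
    using A by (auto simp: positive_op_def bounded_clinear_def)
  have sub: "subspace M"
    unfolding M_def using lin_A(1)
    by (intro subspace_closure linear_subspace_image bounded_linear.linear subspace_UNIV)
  \<comment> \<open>\<open>subspace\<close> concerns real scalars only; closure under complex
    scalars makes \<open>P\<close> complex-linear.\<close>
  have scale: "c *\<^sub>C m \<in> M" if "m \<in> M" for c m
  proof -
    have "(*\<^sub>C) c ` closure (range A) \<subseteq> closure ((*\<^sub>C) c ` range A)"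
      by (rule closure_bounded_linear_image_subset[OF bounded_linear_scaleC])
    also have "\<dots> \<subseteq> closure (range A)"
      by (intro closure_mono) (auto simp: lin_A(2)[symmetric])
    finally show ?thesis using that by (auto simp: M_def)
  qed
  have "\<exists>p. p \<in> M \<and> (\<forall>m\<in>M. inner (x - p) m = 0)" for x
    using orthogonal_projection_exists[OF sub, of x] by (metis M_def closed_closure)
  then obtain P where P: "\<And>x. P x \<in> M" "\<And>x m. m \<in> M \<Longrightarrow> inner (x - P x) m = 0"
    by metis
  \<comment> \<open>Uniqueness of the projection reduces each linearity law for \<open>P\<close> to
    checking that the candidate lies in \<open>M\<close> with orthogonal residual.\<close>
  have P_eq: "P x = p" if p: "p \<in> M" "\<And>m. m \<in> M \<Longrightarrow> inner (x - p) m = 0" for x p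
  proof -
    have "p - P x \<in> M" using p(1) P(1) sub by (simp add: subspace_diff)
    with p(2) P(2) have "inner (x - P x) (p - P x) = 0" "inner (x - p) (p - P x) = 0" by auto
    then have "inner (p - P x) (p - P x) = 0" by (simp add: inner_diff_left)
    then show ?thesis by simp
  qed
  have "bounded_clinear P"
    unfolding bounded_clinear_def
  proof (intro conjI allI)
    show "bounded_linear P"
    proof (rule bounded_linear_intro[where K = 1])
      fix r and x y
      show "P (x + y) = P x + P y"
      proof (rule P_eq)
        show "P x + P y \<in> M" using P(1) sub by (simp add: subspace_add)
        show "inner (x + y - (P x + P y)) m = 0" if "m \<in> M" for m
          using P(2)[OF that, of x] P(2)[OF that, of y] by (simp add: inner_simps)
      qed
      show "P (r *\<^sub>R x) = r *\<^sub>R P x"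
      proof (rule P_eq)
        show "r *\<^sub>R P x \<in> M" using P(1) sub by (simp add: subspace_scale)
        show "inner (r *\<^sub>R x - r *\<^sub>R P x) m = 0" if "m \<in> M" for m
          using P(2)[OF that, of x] by (simp add: inner_simps)
      qed
      have "inner (x - P x) (P x) = 0" using P by simp
      then have "(norm (P x))\<^sup>2 = inner x (P x)"
        by (simp add: power2_norm_eq_inner inner_diff_left)
      also have "\<dots> \<le> norm x * norm (P x)" by (rule norm_cauchy_schwarz)
      finally show "norm (P x) \<le> norm x * 1"
        by (cases "P x = 0") (simp_all add: power2_eq_square)
    qed
    show "P (c *\<^sub>C x) = c *\<^sub>C P x" for c x
    proof (rule P_eq)
      show "c *\<^sub>C P x \<in> M" using P(1) by (rule scale)
      fix m assume "m \<in> M"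
      then have "inner (x - P x) (cnj c *\<^sub>C m) = 0" by (intro P(2) scale)
      then show "inner (c *\<^sub>C x - c *\<^sub>C P x) m = 0"
        by (simp add: Re_cinner[symmetric] cinner_diff_left cinner_scaleC_left cinner_scaleC_right
            algebra_simps)
    qed
  qed
  have AP: "A (P x) = A x" for x
  proof -
    \<comment> \<open>Pairing the residual with this element of \<open>M\<close> and moving one
      \<open>A\<close> across gives the squared norm of \<open>A (x - P x)\<close>, which is
      therefore zero.\<close>
    have "A (A (x - P x)) \<in> M" unfolding M_def by (intro closure_subset[THEN subsetD] rangeI)
    then have "Re (cinner (x - P x) (A (A (x - P x)))) = 0"
      using P(2) by (simp add: Re_cinner)
    then have "Re (cinner (A (x - P x)) (A (x - P x))) = 0"
      by (simp only: positive_op_selfadjoint[OF A, of "x - P x"])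
    then have "A (x - P x) = 0" by (simp add: Re_cinner)
    then show ?thesis
      using bounded_clinear_diffD[OF positive_op_bounded_clinear[OF A]] by simp
  qed
  let ?adj = "\<lambda>S. is_A_adjoint A T S \<and> range S \<subseteq> M"
  have adj_PR: "?adj (\<lambda>x. P (R x))"
  proof (intro conjI)
    have "A_inner A x (P (R y)) = A_inner A x (R y)" for x y
      by (simp add: A_inner_def positive_op_selfadjoint[OF A] AP)
    then show "is_A_adjoint A T (\<lambda>x. P (R x))"
      using R \<open>bounded_clinear P\<close> by (simp add: is_A_adjoint_def bounded_clinear_compose)
    show "range (\<lambda>x. P (R x)) \<subseteq> M" using P(1) by auto
  qed
  have "S = S'" if S: "?adj S" and S': "?adj S'" for S S'
  proof
    fix y
    have "inner (S y - S' y) m = 0" if "m \<in> range A" for m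
    proof -
      from that obtain x where "m = A x" by auto
      moreover have "A_inner A x (S y) = A_inner A x (S' y)"
        using S S' by (metis is_A_adjoint_def)
      ultimately have "inner m (S y - S' y) = 0"
        by (simp add: Re_cinner[symmetric] cinner_diff_right A_inner_def)
      then show ?thesis by (simp add: inner_commute)
    qed
    moreover have "S y - S' y \<in> M" using S S' sub by (auto intro!: subspace_diff)
    ultimately have "inner (S y - S' y) (S y - S' y) = 0"
      using orthogonal_closure[of "range A"] by (simp add: M_def)
    then show "S y = S' y" by simp
  qed
  then have "\<exists>!S. ?adj S" using adj_PR by (intro ex1I)
  then have "?adj (A_sharp A T)"
    unfolding A_sharp_def M_def[symmetric] by (rule theI')
  then show ?thesis by (rule conjunct1)
qed

section \<open>Operator matrices\<close>

lemma A_inner_diagonal: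
  "A_inner (op_matrix A (\<lambda>_. 0) (\<lambda>_. 0) A) (x, y) (x', y') = A_inner A x x' + A_inner A y y'"
  by (simp add: A_inner_def op_matrix_def cinner_prod_def)

lemma positive_op_diagonal:
  assumes "positive_op A"
  shows "positive_op (op_matrix A (\<lambda>_. 0) (\<lambda>_. 0) A)"
  using assms bounded_clinear_op_matrix[OF _ bounded_clinear_zero bounded_clinear_zero, of A A]
  by (auto simp: positive_op_def cinner_prod_def op_matrix_def complex_nonneg_Reals_iff)

lemma A_norm_diagonal:
  assumes "positive_op A"
  shows "(A_norm (op_matrix A (\<lambda>_. 0) (\<lambda>_. 0) A) (x, y))\<^sup>2 = (A_norm A x)\<^sup>2 + (A_norm A y)\<^sup>2"
  using assms by (simp add: A_norm_square positive_op_diagonal A_inner_diagonal)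

lemma is_A_adjoint_op_matrix:
  assumes "positive_op A" "is_A_adjoint A X X'" "is_A_adjoint A Y Y'"
    "is_A_adjoint A Z Z'" "is_A_adjoint A W W'"
  shows "is_A_adjoint (op_matrix A (\<lambda>_. 0) (\<lambda>_. 0) A) (op_matrix X Y Z W) (op_matrix X' Z' Y' W')"
  using assms
  by (auto simp: is_A_adjoint_def bounded_clinear_op_matrix)
    (simp add: op_matrix_def[of X] op_matrix_def[of X'] A_inner_diagonal A_inner_simps)

lemma A_adjointable_op_matrix:
  assumes "positive_op A" "X \<in> A_adjointable A" "Y \<in> A_adjointable A"
    "Z \<in> A_adjointable A" "W \<in> A_adjointable A"
  shows "op_matrix X Y Z W \<in> A_adjointable (op_matrix A (\<lambda>_. 0) (\<lambda>_. 0) A)"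
  using assms is_A_adjoint_op_matrix[OF assms(1)] bounded_clinear_op_matrix[of X Y Z W]
  unfolding A_adjointable_def by blast

text \<open>Turns the sums of squared seminorms left by the arithmetic-geometric mean inequality
  into quadratic forms of the operators inside \<open>A_opnorm\<close>.\<close>

lemma A_norm_square_adjoint:
  assumes "positive_op A" "is_A_adjoint A S R"
  shows "(A_norm A (S x))\<^sup>2 = Re (A_inner A (R (S x)) x)"
  using assms A_inner_commute[of A "R (S x)" x] by (simp add: A_norm_square is_A_adjoint_def)

text \<open>A convex combination of \<open>p\<close> and \<open>q\<close> is at most their maximum.
  In use, \<open>s\<close> and \<open>t\<close> are the squared seminorms of the two components of a
  \<open>B\<close>-unit vector.\<close>

lemma add_scaled_le_max:
  fixes a b p q s t :: real
  assumes "a \<le> p * s" "b \<le> q * t" "0 \<le> s" "0 \<le> t" "s + t = 1"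
  shows "a + b \<le> max p q"
proof -
  have "p * s \<le> max p q * s" "q * t \<le> max p q * t"
    using assms by (auto intro: mult_right_mono)
  then have "a + b \<le> max p q * (s + t)" using assms(1,2) unfolding distrib_left by linarith
  with assms show ?thesis by simp
qed

theorem theorem3p7:
  fixes A X Y Z W :: "'a::complex_hilbert \<Rightarrow> 'a"
    and B :: "'a \<times> 'a \<Rightarrow> 'a \<times> 'a"
  assumes "positive_op A"
    and "B = op_matrix A (\<lambda>_. 0) (\<lambda>_. 0) A"
    and "X \<in> A_adjointable A" "Y \<in> A_adjointable A"
    and "Z \<in> A_adjointable A" "W \<in> A_adjointable A"
  shows "(A_numrad B (op_matrix X Y Z W))\<^sup>2 \<le>
      max ((A_numrad A X)\<^sup>2) ((A_numrad A W)\<^sup>2)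
      + 1/2 * max (A_numrad A (Y \<circ> Z)) (A_numrad A (Z \<circ> Y))
      + A_numrad B (op_matrix (\<lambda>_. 0) (Y \<circ> W) (Z \<circ> X) (\<lambda>_. 0))
      + 1/4 * max (A_opnorm A (\<lambda>x. Y (A_sharp A Y x) + A_sharp A Z (Z x)))
                  (A_opnorm A (\<lambda>x. A_sharp A Y (Y x) + Z (A_sharp A Z x)))
      + 1/2 * max (A_opnorm A (\<lambda>x. A_sharp A X (X x) + Y (A_sharp A Y x)))
                  (A_opnorm A (\<lambda>x. A_sharp A W (W x) + Z (A_sharp A Z x)))"
proof -
  note A = assms(1) and adj = assms(3-6)
  let ?Xs = "A_sharp A X" and ?Ys = "A_sharp A Y" and ?Zs = "A_sharp A Z" and ?Ws = "A_sharp A W"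
  have B: "positive_op B" using A assms(2) by (simp add: positive_op_diagonal)
  note sharp = adj[THEN A_sharp_is_A_adjoint[OF A]]
  \<comment> \<open>Needed to rewrite the squared seminorm of \<open>?Ys x\<close> as the quadratic
    form of \<open>Y\<close> after \<open>?Ys\<close>, and likewise for \<open>Z\<close>.\<close>
  have sharp_sym: "is_A_adjoint A ?Xs X" "is_A_adjoint A ?Ys Y"
      "is_A_adjoint A ?Zs Z" "is_A_adjoint A ?Ws W"
    using sharp adj by (auto intro: is_A_adjoint_sym[OF A] A_adjointable_bounded_clinear)
  have sharp_adj: "?Xs \<in> A_adjointable A" "?Ys \<in> A_adjointable A"
      "?Zs \<in> A_adjointable A" "?Ws \<in> A_adjointable A"
    using sharp sharp_sym by (auto simp: is_A_adjoint_def intro: A_adjointableI)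
  define D where "D = op_matrix X (\<lambda>_. 0) (\<lambda>_. 0) W"
  define S where "S = op_matrix (\<lambda>_. 0) Y Z (\<lambda>_. 0)"
  define S' where "S' = op_matrix (\<lambda>_. 0) ?Zs ?Ys (\<lambda>_. 0)"
  define V where "V = op_matrix (\<lambda>_. 0) (Y \<circ> W) (Z \<circ> X) (\<lambda>_. 0)"
  have SS': "is_A_adjoint B S S'"
    unfolding S_def S'_def assms(2) by (intro is_A_adjoint_op_matrix A is_A_adjoint_zero sharp)
  have V_adj: "V \<in> A_adjointable B"
    unfolding V_def assms(2) comp_def
    by (intro A_adjointable_op_matrix A A_adjointable_zero A_adjointable_compose[OF adj(2,4)]
        A_adjointable_compose[OF adj(3,1)])
  define mw where "mw = max (A_numrad A X) (A_numrad A W)"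
  define m2 where "m2 = max (A_numrad A (Y \<circ> Z)) (A_numrad A (Z \<circ> Y))"
  define m3 where "m3 = A_numrad B V"
  define m4 where "m4 = max (A_opnorm A (\<lambda>x. Y (?Ys x) + ?Zs (Z x)))
                            (A_opnorm A (\<lambda>x. ?Ys (Y x) + Z (?Zs x)))"
  define m5 where "m5 = max (A_opnorm A (\<lambda>x. ?Xs (X x) + Y (?Ys x)))
                            (A_opnorm A (\<lambda>x. ?Ws (W x) + Z (?Zs x)))"
  have YZ: "Y \<circ> Z \<in> A_adjointable A" "Z \<circ> Y \<in> A_adjointable A"
    unfolding comp_def
    by (rule A_adjointable_compose[OF adj(2,3)], rule A_adjointable_compose[OF adj(3,2)])
  have sums: "(\<lambda>x. Y (?Ys x) + ?Zs (Z x)) \<in> A_adjointable A"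
      "(\<lambda>x. ?Ys (Y x) + Z (?Zs x)) \<in> A_adjointable A"
      "(\<lambda>x. ?Xs (X x) + Y (?Ys x)) \<in> A_adjointable A"
      "(\<lambda>x. ?Ws (W x) + Z (?Zs x)) \<in> A_adjointable A"
    by (rule A_adjointable_add[OF A]; rule A_adjointable_compose; fact adj sharp_adj)+
  have unit: "(cmod (A_inner B (op_matrix X Y Z W u) u))\<^sup>2
      \<le> mw\<^sup>2 + 1/2 * m2 + m3 + 1/4 * m4 + 1/2 * m5" if u: "A_norm B u = 1" for u
  proof -
    obtain x y where xy: "u = (x, y)" by (cases u)
    define s where "s = (A_norm A x)\<^sup>2"
    define t where "t = (A_norm A y)\<^sup>2"
    have st: "0 \<le> s" "0 \<le> t" "s + t = 1"
      using u A_norm_diagonal[OF A, of x y] by (simp_all add: s_def t_def xy assms(2))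
    have le_max: "Re (A_inner A (F x) x) + Re (A_inner A (G y) y) \<le> max (A_opnorm A F) (A_opnorm A G)"
      if "F \<in> A_adjointable A" "G \<in> A_adjointable A" for F G
      using A_opnorm_bound(2)[OF A that(1), of x] A_opnorm_bound(2)[OF A that(2), of y]
        complex_Re_le_cmod[of "A_inner A (F x) x"] complex_Re_le_cmod[of "A_inner A (G y) y"] st
      by (intro add_scaled_le_max[of _ _ s _ _ t]) (auto simp: s_def t_def)
    have le_max_numrad:
      "cmod (A_inner A (F x) x + A_inner A (G y) y) \<le> max (A_numrad A F) (A_numrad A G)"
      if "F \<in> A_adjointable A" "G \<in> A_adjointable A" for F G
      using A_numrad_bound(2)[OF A that(1), of x] A_numrad_bound(2)[OF A that(2), of y] st
      by (intro order_trans[OF norm_triangle_ineq] add_scaled_le_max[of _ _ s _ _ t])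
        (auto simp: s_def t_def)
    have Duu: "cmod (A_inner B (D u) u) \<le> mw"
      using le_max_numrad[OF adj(1) adj(4)]
      by (simp add: xy D_def op_matrix_def[of X] assms(2) A_inner_diagonal mw_def)
    \<comment> \<open>The square of \<open>S\<close> is block diagonal with entries YZ and
      ZY.\<close>
    have SSuu: "cmod (A_inner B (S (S u)) u) \<le> m2"
      using le_max_numrad[OF YZ]
      by (simp add: xy S_def op_matrix_def[of "\<lambda>_. 0"] assms(2) A_inner_diagonal m2_def)
    have SDuu: "cmod (A_inner B (S (D u)) u) \<le> m3"
    proof -
      have "S (D u) = V u" by (simp add: xy S_def D_def V_def op_matrix_def)
      then show ?thesis using A_numrad_bound(2)[OF B V_adj, of u] u by (simp add: m3_def)
    qed
    note sq = sharp[THEN A_norm_square_adjoint[OF A]] sharp_sym[THEN A_norm_square_adjoint[OF A]]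
    have nS: "(A_norm B (S u))\<^sup>2 = (A_norm A (Y y))\<^sup>2 + (A_norm A (Z x))\<^sup>2"
      by (simp add: xy S_def op_matrix_def[of "\<lambda>_. 0"] assms(2) A_norm_diagonal[OF A])
    have nS': "(A_norm B (S' u))\<^sup>2 = (A_norm A (?Zs y))\<^sup>2 + (A_norm A (?Ys x))\<^sup>2"
      by (simp add: xy S'_def op_matrix_def[of "\<lambda>_. 0"] assms(2) A_norm_diagonal[OF A])
    have nD: "(A_norm B (D u))\<^sup>2 = (A_norm A (X x))\<^sup>2 + (A_norm A (W y))\<^sup>2"
      by (simp add: xy D_def op_matrix_def[of X] assms(2) A_norm_diagonal[OF A])
    \<comment> \<open>Regrouping by component: the \<open>x\<close> terms come from
      \<open>Z x\<close> and \<open>?Ys x\<close>, the \<open>y\<close> terms from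
      \<open>Y y\<close> and \<open>?Zs y\<close>.\<close>
    have n4: "(A_norm B (S u))\<^sup>2 + (A_norm B (S' u))\<^sup>2 \<le> m4"
      using le_max[OF sums(1,2)] unfolding nS nS' sq m4_def by (simp add: A_inner_simps A)
    have n5: "(A_norm B (D u))\<^sup>2 + (A_norm B (S' u))\<^sup>2 \<le> m5"
      using le_max[OF sums(3,4)] unfolding nD nS' sq m5_def by (simp add: A_inner_simps A)
    have SuS': "A_inner B (S v) u = A_inner B v (S' u)" for v
      using SS' unfolding is_A_adjoint_def by blast
    have amgm: "2 * (a * b) \<le> a\<^sup>2 + b\<^sup>2" for a b :: real
      using sum_squares_bound[of a b] by simp
    \<comment> \<open>Buzano with a = Su and b = S'u: <u,S'u> equals <Su,u>, and <Su,S'u> equals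
      <SSu,u>. Halving gives the coefficients 1/4 and 1/2.\<close>
    have b1: "2 * (cmod (A_inner B (S u) u))\<^sup>2 \<le> 1/2 * m4 + m2"
      using A_Buzano[OF B u, of "S u" "S' u"] amgm[of "A_norm B (S u)" "A_norm B (S' u)"] n4 SSuu
      by (simp add: SuS'[symmetric] norm_mult power2_eq_square)
    \<comment> \<open>The same with a = Du. The factor 2 is that of the cross term in the expanded
      square, so \<open>m3\<close> keeps coefficient 1 and \<open>m5\<close> keeps 1/2.\<close>
    have b2: "2 * (cmod (A_inner B (D u) u) * cmod (A_inner B (S u) u)) \<le> 1/2 * m5 + m3"
      using A_Buzano[OF B u, of "D u" "S' u"] amgm[of "A_norm B (D u)" "A_norm B (S' u)"] n5 SDuu
      by (simp add: SuS'[symmetric] norm_mult)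
    have "op_matrix X Y Z W u = D u + S u" by (simp add: xy D_def S_def op_matrix_def)
    then have "cmod (A_inner B (op_matrix X Y Z W u) u)
        \<le> cmod (A_inner B (D u) u) + cmod (A_inner B (S u) u)"
      by (simp add: A_inner_add_left B norm_triangle_ineq)
    then have "(cmod (A_inner B (op_matrix X Y Z W u) u))\<^sup>2
        \<le> (cmod (A_inner B (D u) u) + cmod (A_inner B (S u) u))\<^sup>2"
      by (intro power_mono) auto
    also have "\<dots> = (cmod (A_inner B (D u) u))\<^sup>2 + (cmod (A_inner B (S u) u))\<^sup>2
        + 2 * (cmod (A_inner B (D u) u) * cmod (A_inner B (S u) u))"
      by (simp add: power2_sum)
    finally show ?thesis
      using b1 b2 power_mono[OF Duu, of 2] by simp
  qed
  let ?r = "mw\<^sup>2 + 1/2 * m2 + m3 + 1/4 * m4 + 1/2 * m5"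
  have nonneg: "0 \<le> mw" "0 \<le> m2" "0 \<le> m3" "0 \<le> m4" "0 \<le> m5"
    using A_numrad_bound(1)[OF A] A_numrad_bound(1)[OF B V_adj] A_opnorm_bound(1)[OF A] adj YZ sums
    by (auto simp: mw_def m2_def m3_def m4_def m5_def le_max_iff_disj)
  \<comment> \<open>The inserted 0 must also lie below the bound, which is where
    \<open>nonneg\<close> enters.\<close>
  have "A_numrad B (op_matrix X Y Z W) \<le> sqrt ?r"
    unfolding A_numrad_def using unit nonneg by (intro cSup_least) (auto intro: real_le_rsqrt)
  moreover have "0 \<le> A_numrad B (op_matrix X Y Z W)"
    using A_numrad_bound(1)[OF B] A_adjointable_op_matrix[OF A adj] by (simp add: assms(2))
  ultimately have "(A_numrad B (op_matrix X Y Z W))\<^sup>2 \<le> (sqrt ?r)\<^sup>2" by (rule power_mono)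
  also have "\<dots> = ?r" using nonneg by simp
  \<comment> \<open>Squaring commutes with the maximum because numerical radii are
    nonnegative.\<close>
  also have "mw\<^sup>2 = max ((A_numrad A X)\<^sup>2) ((A_numrad A W)\<^sup>2)"
    using A_numrad_bound(1)[OF A] adj by (simp add: mw_def max_def power_mono_iff)
  finally show ?thesis by (simp add: m2_def m3_def m4_def m5_def V_def)
qed

end
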